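(* Let $T>0$ and let $\hat\sigma(K,F)$ be an implied volatility smile satisfying the standing assumptions, with $\sigma(x,F)=\hat\sigma(Fe^x,F)$ the smile as a function of log-moneyness $x=\ln(K/F)$. Then for every $F>0$ the gap between the Black-Scholes variance swap delta $\delta_{\mathrm{BS}}$ and the total variance swap delta $dV^*/dF$ is given by $$\delta_{\mathrm{BS}}-\frac{dV^*}{dF}=-\frac2T\int_0^{\infty}\mathcal V\big(F,K,\hat\sigma(K,F)\big)\,\frac{\partial\hat\sigma}{\partial F}(K,F)\,\frac{dK}{K^2}$$ $$=\frac{2}{\sqrt T}\int_{-\infty}^{\infty}n\big(d_2(x,F)\big)\left[\frac1F\frac{\partial\sigma}{\partial x}(x,F)-\frac{\partial\sigma}{\partial F}(x,F)\right]dx,$$ where $d_2(x,F)=\dfrac{-x}{\sigma(x,F)\sqrt T}-\dfrac12\sigma(x,F)\sqrt T$ and $n$ is the standard normal density.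
   Context: Fix a maturity $T>0$. Let $N$ and $n$ be the standard normal cumulative distribution function and density. The undiscounted Black-Scholes call and put prices with forward price $F>0$, strike $K>0$ and volatility $\varsigma>0$ are $$C_{\mathrm{BS}}(F,K,\varsigma)=FN(d_1)-KN(d_2),\qquad P_{\mathrm{BS}}(F,K,\varsigma)=KN(-d_2)-FN(-d_1),\qquad d_{1,2}=\frac{\ln(F/K)}{\varsigma\sqrt T}\pm\tfrac12\varsigma\sqrt T.$$ The Black-Scholes vega is $\mathcal V(F,K,\varsigma)=\partial P_{\mathrm{BS}}/\partial\varsigma=\partial C_{\mathrm{BS}}/\partial\varsigma$. An implied volatility smile is a twice continuously differentiable function $\hat\sigma(K,F)>0$ of strike $K>0$ and forward $F>0$. The fair value of (annualized) variance is $$V^*(F)=\frac2T\int_0^F P_{\mathrm{BS}}\big(F,K,\hat\sigma(K,F)\big)\frac{dK}{K^2}+\frac2T\int_F^{\infty}C_{\mathrm{BS}}\big(F,K,\hat\sigma(K,F)\big)\frac{dK}{K^2},$$ and the total variance swap delta is the derivative $dV^*/dF$. The Black-Scholes variance swap delta is $$\delta_{\mathrm{BS}}=\frac2T\int_0^F\frac{\partial P_{\mathrm{BS}}}{\partial F}\big(F,K,\hat\sigma(K,F)\big)\frac{dK}{K^2}+\frac2T\int_F^\infty\frac{\partial C_{\mathrm{BS}}}{\partial F}\big(F,K,\hat\sigma(K,F)\big)\frac{dK}{K^2},$$ where $\partial P_{\mathrm{BS}}/\partial F$ and $\partial C_{\mathrm{BS}}/\partial F$ are partial derivatives in the first argument,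 with strike and volatility held fixed. Standing assumptions: the integrals defining $V^*(F)$ and $\delta_{\mathrm{BS}}$ converge absolutely for every $F>0$, and the conditions for differentiation under the integral sign with respect to $F$ are met. Concretely, each of the functions of $K$ given by $K^{-2}\frac{\partial P_{\mathrm{BS}}}{\partial F}(F,K,\hat\sigma(K,F))$ (near $K=0$, i.e. on $(0,F]$), $K^{-2}\frac{\partial C_{\mathrm{BS}}}{\partial F}(F,K,\hat\sigma(K,F))$ (near $K=\infty$, i.e. on $[F,\infty)$) and $K^{-2}\mathcal V(F,K,\hat\sigma(K,F))\frac{\partial\hat\sigma}{\partial F}(K,F)$ (on $(0,\infty)$) is dominated in absolute value, locally uniformly in $F$, by an integrable function of $K$. *)

theory Defs
  imports "HOL-Probability.Probability"
begin

subsection \<open>Undiscounted Black-Scholes prices\<close>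

abbreviation Phi :: "real \<Rightarrow> real" where
  "Phi \<equiv> cdf std_normal_distribution"

definition bs_d1 :: "real \<Rightarrow> real \<Rightarrow> real \<Rightarrow> real \<Rightarrow> real" where
  "bs_d1 T F K s = ln (F / K) / (s * sqrt T) + s * sqrt T / 2"

definition bs_d2 :: "real \<Rightarrow> real \<Rightarrow> real \<Rightarrow> real \<Rightarrow> real" where
  "bs_d2 T F K s = ln (F / K) / (s * sqrt T) - s * sqrt T / 2"

definition bs_call :: "real \<Rightarrow> real \<Rightarrow> real \<Rightarrow> real \<Rightarrow> real" where
  "bs_call T F K s = F * Phi (bs_d1 T F K s) - K * Phi (bs_d2 T F K s)"

definition bs_put :: "real \<Rightarrow> real \<Rightarrow> real \<Rightarrow> real \<Rightarrow> real" where
  "bs_put T F K s = K * Phi (- bs_d2 T F K s) - F * Phi (- bs_d1 T F K s)"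

definition bs_call_delta :: "real \<Rightarrow> real \<Rightarrow> real \<Rightarrow> real \<Rightarrow> real" where
  "bs_call_delta T F K s = deriv (\<lambda>G. bs_call T G K s) F"

definition bs_put_delta :: "real \<Rightarrow> real \<Rightarrow> real \<Rightarrow> real \<Rightarrow> real" where
  "bs_put_delta T F K s = deriv (\<lambda>G. bs_put T G K s) F"

definition bs_vega :: "real \<Rightarrow> real \<Rightarrow> real \<Rightarrow> real \<Rightarrow> real" where
  "bs_vega T F K s = deriv (\<lambda>u. bs_put T F K u) s"

lemma Phi_minus: "Phi (- x) = 1 - Phi x"
proof -
  interpret real_distribution std_normal_distribution
    by (rule real_dist_normal_dist)
  have "Phi (- x) = measure std_normal_distribution {x..}"
  proof -
    have "emeasure std_normal_distribution {..- x} = emeasure std_normal_distribution {x..}"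
    proof -
      have "emeasure std_normal_distribution {..- x}
          = (\<integral>\<^sup>+y. ennreal (std_normal_density y) * indicator {..- x} y \<partial>lborel)"
        by (subst emeasure_density) auto
      also have "\<dots> = (\<integral>\<^sup>+y. ennreal (std_normal_density (- y)) * indicator {..- x} (- y) \<partial>lborel)"
        by (subst nn_integral_real_affine[where c = "-1" and t = 0]) auto
      also have "\<dots> = (\<integral>\<^sup>+y. ennreal (std_normal_density y) * indicator {x..} y \<partial>lborel)"
        by (intro nn_integral_cong) (auto simp: normal_density_def indicator_def)
      also have "\<dots> = emeasure std_normal_distribution {x..}"
        by (subst emeasure_density) auto
      finally show ?thesis .
    qed
    then show ?thesis by (simp add: cdf_def measure_def)
  qed
  also have "\<dots> = measure std_normal_distribution {x<..}"
  proof -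
    have "emeasure std_normal_distribution {x..} = emeasure std_normal_distribution {x<..}"
    proof -
      have "AE y in lborel. y \<noteq> x" by (rule AE_lborel_singleton)
      then show ?thesis
        by (auto simp: emeasure_density indicator_def intro!: nn_integral_cong_AE
            elim!: eventually_mono)
    qed
    then show ?thesis by (simp add: measure_def)
  qed
  also have "\<dots> = 1 - Phi x"
    using prob_compl[of "{..x}"] by (simp add: cdf_def Compl_eq_Diff_UNIV[symmetric])
  finally show ?thesis .
qed

lemma put_call_parity: "bs_call T F K s - bs_put T F K s = F - K"
  by (simp add: bs_call_def bs_put_def Phi_minus algebra_simps)

lemma bs_vega_call: "bs_vega T F K s = deriv (\<lambda>u. bs_call T F K u) s"
proof -
  have "(\<lambda>u. bs_call T F K u) = (\<lambda>u. bs_put T F K u + (F - K))"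
    using put_call_parity[of T F K] by (auto simp: algebra_simps)
  moreover have "((\<lambda>u. bs_put T F K u + (F - K)) has_field_derivative D) (at s)
      \<longleftrightarrow> ((\<lambda>u. bs_put T F K u) has_field_derivative D) (at s)" for D
    by (simp add: has_field_derivative_iff)
  ultimately show ?thesis
    by (simp add: bs_vega_def deriv_def)
qed


subsection \<open>Implied volatility smiles\<close>

definition C2_on :: "('a::real_normed_vector \<Rightarrow> 'b::real_normed_vector) \<Rightarrow> 'a set \<Rightarrow> bool" where
  "C2_on f S \<longleftrightarrow> (\<exists>(f' :: 'a \<Rightarrow> 'a \<Rightarrow>\<^sub>L 'b) (f'' :: 'a \<Rightarrow> 'a \<Rightarrow>\<^sub>L 'a \<Rightarrow>\<^sub>L 'b).
     (\<forall>p\<in>S. (f has_derivative blinfun_apply (f' p)) (at p)) \<and>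
     (\<forall>p\<in>S. (f' has_derivative blinfun_apply (f'' p)) (at p)) \<and>
     continuous_on S f'')"

text \<open>The arguments of a smile are the strike and the forward, in this order; its values
  outside the open positive quadrant are irrelevant.\<close>

definition implied_vol_smile :: "(real \<Rightarrow> real \<Rightarrow> real) \<Rightarrow> bool" where
  "implied_vol_smile vol \<longleftrightarrow>
     (\<forall>K>0. \<forall>F>0. vol K F > 0) \<and> C2_on (\<lambda>(K, F). vol K F) ({0<..} \<times> {0<..})"

definition logm_smile :: "(real \<Rightarrow> real \<Rightarrow> real) \<Rightarrow> real \<Rightarrow> real \<Rightarrow> real" where
  "logm_smile vol x F = vol (F * exp x) F"

definition logm_d2 :: "real \<Rightarrow> (real \<Rightarrow> real \<Rightarrow> real) \<Rightarrow> real \<Rightarrow> real \<Rightarrow> real" where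
  "logm_d2 T vol x F =
     - x / (logm_smile vol x F * sqrt T) - logm_smile vol x F * sqrt T / 2"


subsection \<open>Fair variance and variance swap deltas\<close>

definition fair_variance :: "real \<Rightarrow> (real \<Rightarrow> real \<Rightarrow> real) \<Rightarrow> real \<Rightarrow> real" where
  "fair_variance T vol F =
     2 / T * (LBINT K:{0<..F}. bs_put T F K (vol K F) / K\<^sup>2) +
     2 / T * (LBINT K:{F..}. bs_call T F K (vol K F) / K\<^sup>2)"

definition bs_variance_delta :: "real \<Rightarrow> (real \<Rightarrow> real \<Rightarrow> real) \<Rightarrow> real \<Rightarrow> real" where
  "bs_variance_delta T vol F =
     2 / T * (LBINT K:{0<..F}. bs_put_delta T F K (vol K F) / K\<^sup>2) +
     2 / T * (LBINT K:{F..}. bs_call_delta T F K (vol K F) / K\<^sup>2)"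

text \<open>The domain of the integration variable may move with the parameter, as for
  \<open>{0<..F}\<close> and \<open>{F..}\<close>; the bound is only required on that domain.\<close>

definition locally_uniformly_dominated ::
    "(real \<Rightarrow> real set) \<Rightarrow> (real \<Rightarrow> real \<Rightarrow> real) \<Rightarrow> bool" where
  "locally_uniformly_dominated A h \<longleftrightarrow>
     (\<forall>F0>0. \<exists>g. integrable lborel g \<and>
        (\<forall>\<^sub>F F in nhds F0. \<forall>K\<in>A F. \<bar>h F K\<bar> \<le> g K))"

definition variance_swap_assumptions :: "real \<Rightarrow> (real \<Rightarrow> real \<Rightarrow> real) \<Rightarrow> bool" where
  "variance_swap_assumptions T vol \<longleftrightarrow>
     (\<forall>F>0.
        set_integrable lborel {0<..F} (\<lambda>K. bs_put T F K (vol K F) / K\<^sup>2) \<and>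
        set_integrable lborel {F..} (\<lambda>K. bs_call T F K (vol K F) / K\<^sup>2) \<and>
        set_integrable lborel {0<..F} (\<lambda>K. bs_put_delta T F K (vol K F) / K\<^sup>2) \<and>
        set_integrable lborel {F..} (\<lambda>K. bs_call_delta T F K (vol K F) / K\<^sup>2)) \<and>
     locally_uniformly_dominated (\<lambda>F. {0<..F})
       (\<lambda>F K. bs_put_delta T F K (vol K F) / K\<^sup>2) \<and>
     locally_uniformly_dominated (\<lambda>F. {F..})
       (\<lambda>F K. bs_call_delta T F K (vol K F) / K\<^sup>2) \<and>
     locally_uniformly_dominated (\<lambda>F. {0<..})
       (\<lambda>F K. bs_vega T F K (vol K F) * deriv (\<lambda>G. vol K G) F / K\<^sup>2)"

end

theory Submission
  imports Defs
begin

text \<open>For fixed strike \<open>K\<close>, the out-of-the-money price is a put for \<open>F \<ge> K\<close> and a call for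
  \<open>F \<le> K\<close>; the two branches agree at \<open>F = K\<close> by put-call parity, so the moving boundary of the
  integrals contributes nothing and the price is Lipschitz in \<open>F\<close> with a kink at \<open>K\<close> only.
  Dominated convergence of the difference quotients therefore gives \<open>dV*/dF\<close> as the integral of
  the total derivative, which is delta plus vega times the derivative of the smile in \<open>F\<close>.
  The second form follows from vega \<open>= K sqrt T n(d2)\<close> and the substitution \<open>K = F exp x\<close>.\<close>

section \<open>The normal distribution function and the Black-Scholes Greeks\<close>

text \<open>Near \<open>x\<close>, \<open>Phi\<close> differs by the constant
  \<open>Phi (x - 1)\<close> from the integral of the density started at \<open>x - 1\<close>, so
  the fundamental theorem of calculus applies on a bounded interval with \<open>x\<close> in its
  interior.\<close>

lemma Phi_has_real_derivative:
  "(Phi has_real_derivative std_normal_density x) (at x)"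
proof -
  interpret real_distribution std_normal_distribution
    by (rule real_dist_normal_dist)
  have cont: "continuous_on S std_normal_density" for S :: "real set"
    unfolding normal_density_def by (intro continuous_intros) auto
  have Phi_eq: "Phi u = Phi (x - 1) + integral {x - 1..u} std_normal_density"
    if "u \<in> {x - 1<..<x + 1}" for u
  proof -
    have int: "integrable lborel (\<lambda>y. std_normal_density y * indicator {x - 1..u} y)"
      using integrable_mult_indicator[of "{x - 1..u}" lborel std_normal_density]
      by (simp add: mult.commute)
    have "Phi u - Phi (x - 1) = measure std_normal_distribution {x - 1<..u}"
      using that by (intro cdf_diff_eq) auto
    also have "\<dots> = enn2real (\<integral>\<^sup>+y. ennreal (std_normal_density y) * indicator {x - 1<..u} y \<partial>lborel)"
      by (subst measure_def, subst emeasure_density) auto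
    \<comment> \<open>The cdf difference yields a half-open interval, the fundamental theorem wants
      a closed one; they differ in the null set of the point \<open>x - 1\<close>.\<close>
    also have "(\<integral>\<^sup>+y. ennreal (std_normal_density y) * indicator {x - 1<..u} y \<partial>lborel) =
               (\<integral>\<^sup>+y. ennreal (std_normal_density y * indicator {x - 1..u} y) \<partial>lborel)"
      using AE_lborel_singleton[of "x - 1"]
      by (intro nn_integral_cong_AE) (auto simp: indicator_def elim!: eventually_mono)
    also have "enn2real \<dots> = (\<integral>y. std_normal_density y * indicator {x - 1..u} y \<partial>lborel)"
      by (intro integral_eq_nn_integral[symmetric]) auto
    also have "\<dots> = (LBINT y:{x - 1..u}. std_normal_density y)"
      by (simp add: set_lebesgue_integral_def mult.commute)
    also have "\<dots> = integral {x - 1..u} std_normal_density"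
      using int by (intro set_borel_integral_eq_integral(2)) (simp add: set_integrable_def mult.commute)
    finally show ?thesis by simp
  qed
  have "((\<lambda>u. integral {x - 1..u} std_normal_density) has_real_derivative std_normal_density x)
      (at x within {x - 1..x + 1})"
    by (intro integral_has_real_derivative cont) auto
  then have "((\<lambda>u. integral {x - 1..u} std_normal_density) has_real_derivative std_normal_density x)
      (at x)"
    by (subst (asm) at_within_interior) auto
  then have "((\<lambda>u. Phi (x - 1) + integral {x - 1..u} std_normal_density) has_real_derivative
      std_normal_density x) (at x)"
    by (auto intro!: derivative_eq_intros)
  then show ?thesis
    by (rule has_field_derivative_transform_within_open[where S = "{x - 1<..<x + 1}"])
       (use Phi_eq in auto)
qed

text \<open>The squares of \<open>d1\<close> and \<open>d2\<close> differ by
  \<open>2 * ln (F / K)\<close>, so the ratio of the two densities is \<open>K / F\<close>. This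
  identity cancels the indirect dependence of the price on the forward through \<open>d1\<close> and
  \<open>d2\<close>.\<close>

lemma std_normal_density_d1_d2:
  assumes "T > 0" "F > 0" "K > 0" "s > 0"
  shows "F * std_normal_density (bs_d1 T F K s) = K * std_normal_density (bs_d2 T F K s)"
proof -
  define a where "a = ln (F / K) / (s * sqrt T)"
  define b where "b = s * sqrt T"
  have ab: "a * b = ln (F / K)"
    using assms by (simp add: a_def b_def)
  have "- ((bs_d1 T F K s)\<^sup>2 / 2) = - ((bs_d2 T F K s)\<^sup>2 / 2) - a * b"
    unfolding bs_d1_def bs_d2_def a_def[symmetric] unfolding b_def[symmetric]
    by (simp add: power2_eq_square field_simps)
  then have "exp (- ((bs_d1 T F K s)\<^sup>2 / 2)) = exp (- ((bs_d2 T F K s)\<^sup>2 / 2)) / (F / K)"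
    using assms by (simp only: ab exp_diff) simp
  then show ?thesis
    using assms by (simp add: std_normal_density_def)
qed

text \<open>The derivative along an arbitrary curve \<open>(f, v)\<close> in the (forward, volatility) plane
  yields the put delta, the vega and the total derivative along the smile at once.\<close>

lemma bs_put_has_real_derivative:
  assumes T: "T > 0" and K: "K > 0" and pos: "f t > 0" "v t > 0"
    and f: "(f has_real_derivative f') (at t)" and v: "(v has_real_derivative v') (at t)"
  shows "((\<lambda>u. bs_put T (f u) K (v u)) has_real_derivative
      K * sqrt T * std_normal_density (bs_d2 T (f t) K (v t)) * v'
        - Phi (- bs_d1 T (f t) K (v t)) * f') (at t)"
proof -
  define a where "a = (\<lambda>u. ln (f u / K) / (v u * sqrt T))"
  define b where "b = (\<lambda>u. v u * sqrt T / 2)"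
  have d1: "bs_d1 T (f u) K (v u) = a u + b u" and d2: "bs_d2 T (f u) K (v u) = a u - b u" for u
    by (simp_all add: bs_d1_def bs_d2_def a_def b_def)
  \<comment> \<open>The value of \<open>a'\<close> can stay unspecified: its contributions cancel by
    \<open>n\<close> below.\<close>
  obtain a' where a': "(a has_real_derivative a') (at t)"
  proof -
    have "a differentiable (at t)"
      unfolding a_def using T K pos f v
      by (intro derivative_intros)
         (auto simp: real_differentiable_def intro!: exI derivative_eq_intros)
    then show thesis using that by (auto simp: real_differentiable_def)
  qed
  have b': "(b has_real_derivative (v' * sqrt T / 2)) (at t)"
    unfolding b_def by (auto intro!: derivative_eq_intros v)
  have n: "f t * std_normal_density (a t + b t) = K * std_normal_density (a t - b t)"
    using std_normal_density_d1_d2[OF T pos(1) K pos(2)] by (simp add: d1 d2)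
  have even: "std_normal_density (- x) = std_normal_density x" for x
    by (simp add: std_normal_density_def)
  have P1: "((\<lambda>u. Phi (- (a u + b u))) has_real_derivative
      std_normal_density (a t + b t) * - (a' + v' * sqrt T / 2)) (at t)"
    using DERIV_chain2[OF Phi_has_real_derivative DERIV_minus[OF DERIV_add[OF a' b']]]
    by (simp only: even)
  have P2: "((\<lambda>u. Phi (- (a u - b u))) has_real_derivative
      std_normal_density (a t - b t) * - (a' - v' * sqrt T / 2)) (at t)"
    using DERIV_chain2[OF Phi_has_real_derivative DERIV_minus[OF DERIV_diff[OF a' b']]]
    by (simp only: even)
  have "((\<lambda>u. K * Phi (- (a u - b u)) - f u * Phi (- (a u + b u))) has_real_derivative
      K * (std_normal_density (a t - b t) * - (a' - v' * sqrt T / 2))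
        - (f' * Phi (- (a t + b t))
           + (std_normal_density (a t + b t) * - (a' + v' * sqrt T / 2)) * f t)) (at t)"
    by (intro DERIV_diff DERIV_cmult DERIV_mult P1 P2 f)
  also have "K * (std_normal_density (a t - b t) * - (a' - v' * sqrt T / 2))
        - (f' * Phi (- (a t + b t))
           + (std_normal_density (a t + b t) * - (a' + v' * sqrt T / 2)) * f t) =
      K * (std_normal_density (a t - b t) * - (a' - v' * sqrt T / 2))
        - f' * Phi (- (a t + b t))
        + (f t * std_normal_density (a t + b t)) * (a' + v' * sqrt T / 2)"
    by (simp add: algebra_simps)
  \<comment> \<open>After rewriting with \<open>n\<close> both density terms carry the same factor;
    \<open>a'\<close> drops out and the two halves \<open>v' * sqrt T / 2\<close> add up.\<close>
  also have "\<dots> = K * sqrt T * std_normal_density (a t - b t) * v' - Phi (- (a t + b t)) * f'"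
    unfolding n by (simp add: algebra_simps)
  finally show ?thesis
    unfolding bs_put_def d1 d2 .
qed

lemma bs_vega_eq:
  assumes "T > 0" "F > 0" "K > 0" "s > 0"
  shows "bs_vega T F K s = K * sqrt T * std_normal_density (bs_d2 T F K s)"
  using bs_put_has_real_derivative[of T K "\<lambda>_. F" s "\<lambda>u. u" 0 1] assms
  by (simp add: bs_vega_def DERIV_imp_deriv)

lemma bs_put_delta_eq:
  assumes "T > 0" "F > 0" "K > 0" "s > 0"
  shows "bs_put_delta T F K s = - Phi (- bs_d1 T F K s)"
  using bs_put_has_real_derivative[of T K "\<lambda>u. u" F "\<lambda>_. s" 1 0] assms
  by (simp add: bs_put_delta_def DERIV_imp_deriv)

text \<open>Parity oriented so as to turn calls into puts: only the put has to be
  differentiated.\<close>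

lemma bs_call_eq: "bs_call T F K s = bs_put T F K s + (F - K)"
  using put_call_parity[of T F K s] by simp

lemma bs_call_delta_eq:
  assumes "T > 0" "F > 0" "K > 0" "s > 0"
  shows "bs_call_delta T F K s = 1 - Phi (- bs_d1 T F K s)"
proof -
  have "((\<lambda>G. bs_call T G K s) has_real_derivative (- Phi (- bs_d1 T F K s)) + (1 - 0)) (at F)"
    unfolding bs_call_eq
    using bs_put_has_real_derivative[of T K "\<lambda>u. u" F "\<lambda>_. s" 1 0] assms
    by (intro DERIV_add DERIV_diff) auto
  then show ?thesis
    by (simp add: bs_call_delta_def DERIV_imp_deriv)
qed

text \<open>Moving along the curve \<open>(u, v u)\<close> splits the total derivative into a delta
  part and a smile part; the smile part, once integrated, is the gap of the theorem.\<close>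

lemma bs_put_smile_derivative:
  assumes "T > 0" "F > 0" "K > 0" "v F > 0" "(v has_real_derivative v') (at F)"
  shows "((\<lambda>G. bs_put T G K (v G)) has_real_derivative
      bs_put_delta T F K (v F) + bs_vega T F K (v F) * v') (at F)"
  using bs_put_has_real_derivative[of T K "\<lambda>u. u" F v 1 v'] assms
  by (simp add: bs_put_delta_eq bs_vega_eq)

lemma bs_call_smile_derivative:
  assumes "T > 0" "F > 0" "K > 0" "v F > 0" "(v has_real_derivative v') (at F)"
  shows "((\<lambda>G. bs_call T G K (v G)) has_real_derivative
      bs_call_delta T F K (v F) + bs_vega T F K (v F) * v') (at F)"
proof -
  have "((\<lambda>G. bs_call T G K (v G)) has_real_derivative
      (bs_put_delta T F K (v F) + bs_vega T F K (v F) * v') + (1 - 0)) (at F)"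
    unfolding bs_call_eq using assms
    by (intro DERIV_add DERIV_diff bs_put_smile_derivative) auto
  then show ?thesis
    using assms by (simp add: bs_put_delta_eq bs_call_delta_eq algebra_simps)
qed

section \<open>Lipschitz bounds across a kink and differentiation under the integral\<close>

text \<open>The glued function may fail to be differentiable at \<open>k\<close>, so the mean value
  bound is used on each side separately. Two points on opposite sides are compared through the
  common value at \<open>k\<close>; as \<open>k\<close> lies between them, the two distances add up
  and the constant \<open>B\<close> is preserved.\<close>

lemma kink_lipschitz:
  fixes p c :: "real \<Rightarrow> real"
  assumes x: "x \<in> {a..b}" and y: "y \<in> {a..b}"
    and p: "\<And>z. z \<in> {a..b} \<Longrightarrow> k \<le> z \<Longrightarrow> (p has_real_derivative p' z) (at z) \<and> \<bar>p' z\<bar> \<le> B"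
    and c: "\<And>z. z \<in> {a..b} \<Longrightarrow> z \<le> k \<Longrightarrow> (c has_real_derivative c' z) (at z) \<and> \<bar>c' z\<bar> \<le> B"
    and eq: "p k = c k"
  shows "\<bar>(if k \<le> x then p x else c x) - (if k \<le> y then p y else c y)\<bar> \<le> B * \<bar>x - y\<bar>"
proof -
  have right: "\<bar>p u - p w\<bar> \<le> B * \<bar>u - w\<bar>"
    if "u \<in> {a..b}" "w \<in> {a..b}" "k \<le> u" "k \<le> w" for u w
    using field_differentiable_bound[of "{max k a..b}" p p' B u w] that p
    by (auto intro: has_field_derivative_at_within)
  have left: "\<bar>c u - c w\<bar> \<le> B * \<bar>u - w\<bar>"
    if "u \<in> {a..b}" "w \<in> {a..b}" "u \<le> k" "w \<le> k" for u w
    using field_differentiable_bound[of "{a..min k b}" c c' B u w] that c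
    by (auto intro: has_field_derivative_at_within)
  have mixed: "\<bar>p u - c w\<bar> \<le> B * \<bar>u - w\<bar>"
    if "u \<in> {a..b}" "w \<in> {a..b}" "k \<le> u" "w < k" for u w
  proof -
    have k: "k \<in> {a..b}" using that by auto
    have "\<bar>p u - c w\<bar> \<le> \<bar>p u - p k\<bar> + \<bar>c k - c w\<bar>" using eq by simp
    also have "\<dots> \<le> B * \<bar>u - k\<bar> + B * \<bar>k - w\<bar>"
      using right[of u k] left[of k w] that k by (intro add_mono) auto
    also have "\<dots> = B * \<bar>u - w\<bar>"
      using that by (simp add: algebra_simps)
    finally show ?thesis .
  qed
  show ?thesis
    using right[OF x y] left[OF x y] mixed[OF x y] mixed[OF y x]
    by (auto simp: abs_minus_commute)
qed

text \<open>By the Lipschitz bound \<open>w\<close> dominates the difference quotients at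
  \<open>F\<close>, and dominated convergence applies along every sequence tending to
  \<open>F\<close>. The bound compares with the base point \<open>F\<close> only, and its
  exceptional null set may depend on \<open>G\<close>; this accommodates an integrand that is
  irregular at a moving strike.\<close>

lemma has_real_derivative_integral_dominated:
  fixes q :: "real \<Rightarrow> 'a \<Rightarrow> real"
  assumes int: "eventually (\<lambda>G. integrable M (q G)) (nhds F)"
    and w: "integrable M w"
    and lip: "eventually (\<lambda>G. AE K in M. \<bar>q G K - q F K\<bar> \<le> w K * \<bar>G - F\<bar>) (nhds F)"
    and der: "AE K in M. ((\<lambda>G. q G K) has_real_derivative d K) (at F)"
    and d: "d \<in> borel_measurable M"
  shows "((\<lambda>G. \<integral>K. q G K \<partial>M) has_real_derivative (\<integral>K. d K \<partial>M)) (at F)"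
  unfolding has_field_derivative_iff tendsto_at_iff_sequentially
proof (intro allI impI)
  fix X :: "nat \<Rightarrow> real"
  assume X: "\<forall>i. X i \<in> UNIV - {F}" "X \<longlonglongrightarrow> F"
  let ?Q = "\<lambda>n K. (q (X n) K - q F K) / (X n - F)"
  have intF: "integrable M (q F)" using int by (rule eventually_nhds_x_imp_x)
  have "eventually (\<lambda>n. integrable M (q (X n)) \<and>
      (AE K in M. \<bar>q (X n) K - q F K\<bar> \<le> w K * \<bar>X n - F\<bar>)) sequentially"
    using eventually_conj[OF int lip] X(2) by (rule eventually_compose_filterlim)
  then obtain N where N: "\<And>n. n \<ge> N \<Longrightarrow> integrable M (q (X n))"
      "\<And>n. n \<ge> N \<Longrightarrow> AE K in M. \<bar>q (X n) K - q F K\<bar> \<le> w K * \<bar>X n - F\<bar>"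
    by (auto simp: eventually_sequentially)
  \<comment> \<open>Integrability and the bound hold only close to \<open>F\<close>, whereas
    dominated convergence wants them for all indices; hence the shift by \<open>N\<close>.\<close>
  have "(\<lambda>n. \<integral>K. ?Q (n + N) K \<partial>M) \<longlonglongrightarrow> (\<integral>K. d K \<partial>M)"
  proof (rule integral_dominated_convergence[OF d _ w])
    show "?Q (n + N) \<in> borel_measurable M" for n
      using N(1)[of "n + N"] intF by auto
    show "AE K in M. (\<lambda>n. ?Q (n + N) K) \<longlonglongrightarrow> d K"
      using der
    proof eventually_elim
      case (elim K)
      then have "(\<lambda>n. ?Q n K) \<longlonglongrightarrow> d K"
        using X unfolding has_field_derivative_iff tendsto_at_iff_sequentially comp_def by blast
      then show ?case by (rule LIMSEQ_ignore_initial_segment)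
    qed
    show "AE K in M. norm (?Q (n + N) K) \<le> w K" for n
      using N(2)[of "n + N", OF le_add2]
    proof eventually_elim
      case (elim K)
      moreover have "\<bar>X (n + N) - F\<bar> > 0" using X(1) by auto
      ultimately show ?case by (simp add: abs_divide pos_divide_le_eq)
    qed
  qed
  also have "(\<lambda>n. \<integral>K. ?Q (n + N) K \<partial>M) =
      (\<lambda>n. ((\<integral>K. q (X (n + N)) K \<partial>M) - (\<integral>K. q F K \<partial>M)) / (X (n + N) - F))"
    using N(1)[OF le_add2] intF by (intro ext) simp
  finally show "((\<lambda>y. ((\<integral>K. q y K \<partial>M) - (\<integral>K. q F K \<partial>M)) / (y - F)) \<circ> X)
      \<longlonglongrightarrow> (\<integral>K. d K \<partial>M)"
    unfolding comp_def by (rule LIMSEQ_offset)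
qed

section \<open>Exponential substitution and partial derivatives of the smile\<close>

text \<open>The map \<open>c * exp x\<close> is a bijection from the line onto the positive
  half-line and equals its own derivative. The change of variables theorem works with absolute
  integrability for the completed measure, so Borel measurability is proved separately to return to
  \<open>lborel\<close>.\<close>

lemma lborel_substitution_exp:
  fixes h :: "real \<Rightarrow> real"
  assumes h: "set_integrable lborel {0<..} h" and c: "c > 0"
  shows "integrable lborel (\<lambda>x. c * exp x * h (c * exp x))"
    and "(LBINT x. c * exp x * h (c * exp x)) = (LBINT y:{0<..}. h y)"
proof -
  have "(\<lambda>y. indicator {0<..} y *\<^sub>R h y) \<in> borel_measurable lborel"
    using h unfolding set_integrable_def by (rule borel_measurable_integrable)
  then have meas: "(\<lambda>y. indicator {0<..} y *\<^sub>R h y) \<in> borel_measurable borel" by simp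
  \<comment> \<open>Along the substitution the indicator is constantly 1, so it can be removed in
    the next step.\<close>
  have "(\<lambda>x. c * exp x * (indicator {0<..} (c * exp x) *\<^sub>R h (c * exp x))) \<in> borel_measurable borel"
    by (intro borel_measurable_times measurable_compose[OF _ meas]) auto
  then have m: "(\<lambda>x. c * exp x * h (c * exp x)) \<in> borel_measurable lborel"
    using c by simp
  have img: "range (\<lambda>x. c * exp x) = {0<..}"
  proof -
    have "y \<in> range (\<lambda>x. c * exp x)" if "y > 0" for y
      using that c by (intro image_eqI[of _ _ "ln (y / c)"]) auto
    then show ?thesis using c by auto
  qed
  have habs: "h absolutely_integrable_on {0<..}"
    using h unfolding set_integrable_def
    by (subst integrable_completion) (auto intro: borel_measurable_integrable)
  have "(\<lambda>x. \<bar>c * exp x\<bar> * h (c * exp x)) absolutely_integrable_on UNIV \<and>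
      integral UNIV (\<lambda>x. \<bar>c * exp x\<bar> * h (c * exp x)) = integral {0<..} h"
    using habs c img
    by (subst has_absolute_integral_change_of_variables_1'[where g = "\<lambda>x. c * exp x"])
       (auto intro!: derivative_eq_intros simp: inj_on_def)
  then have *: "(\<lambda>x. c * exp x * h (c * exp x)) absolutely_integrable_on UNIV"
      "integral UNIV (\<lambda>x. c * exp x * h (c * exp x)) = integral {0<..} h"
    using c by simp_all
  show int: "integrable lborel (\<lambda>x. c * exp x * h (c * exp x))"
    using *(1) m by (simp add: set_integrable_def integrable_completion)
  show "(LBINT x. c * exp x * h (c * exp x)) = (LBINT y:{0<..}. h y)"
    using int *(2) set_borel_integral_eq_integral(2)[OF h] by (simp add: integral_lborel)
qed

text \<open>The partials are the Frechet derivative evaluated at the two basis vectors. The chain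
  rule is stated for arbitrary curves because it is needed at fixed strike, at fixed forward, and at
  fixed log-moneyness, where strike and forward move together. Continuity of \<open>vF\<close> holds
  because the first derivative is itself differentiable; it later provides measurability.\<close>

lemma C2_on_partials:
  assumes "C2_on (\<lambda>(K, F). vol K F) ({0<..} \<times> {0<..} :: (real \<times> real) set)"
  obtains vK vF :: "real \<Rightarrow> real \<Rightarrow> real" where
    "\<And>f g t a b. f t > 0 \<Longrightarrow> g t > 0 \<Longrightarrow> (f has_real_derivative a) (at t) \<Longrightarrow>
      (g has_real_derivative b) (at t) \<Longrightarrow>
      ((\<lambda>u. vol (f u) (g u)) has_real_derivative a * vK (f t) (g t) + b * vF (f t) (g t)) (at t)"
    and "\<And>F. F > 0 \<Longrightarrow> continuous_on {0<..} (\<lambda>K. vF K F)"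
proof -
  obtain f' :: "real \<times> real \<Rightarrow> (real \<times> real) \<Rightarrow>\<^sub>L real" and
      f'' :: "real \<times> real \<Rightarrow> (real \<times> real) \<Rightarrow>\<^sub>L (real \<times> real) \<Rightarrow>\<^sub>L real" where
    f': "\<And>p. p \<in> {0<..} \<times> {0<..} \<Longrightarrow> ((\<lambda>(K, F). vol K F) has_derivative blinfun_apply (f' p)) (at p)"
    and f'': "\<And>p. p \<in> {0<..} \<times> {0<..} \<Longrightarrow> (f' has_derivative blinfun_apply (f'' p)) (at p)"
    using assms unfolding C2_on_def by blast
  show thesis
  proof (rule that[where vK = "\<lambda>K F. f' (K, F) (1, 0)" and vF = "\<lambda>K F. f' (K, F) (0, 1)"])
    fix f g :: "real \<Rightarrow> real" and t a b :: real
    assume A: "f t > 0" "g t > 0" "(f has_real_derivative a) (at t)" "(g has_real_derivative b) (at t)"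
    have "((\<lambda>u. (f u, g u)) has_derivative (\<lambda>h. (a * h, b * h))) (at t)"
      using A(3,4) by (intro has_derivative_Pair) (simp_all add: has_field_derivative_def)
    from has_derivative_compose[OF this f'[of "(f t, g t)"]] A(1,2)
    have "((\<lambda>u. vol (f u) (g u)) has_derivative (\<lambda>h. f' (f t, g t) (a * h, b * h))) (at t)"
      by simp
    moreover have "f' (f t, g t) (a * h, b * h) = (a * f' (f t, g t) (1, 0) + b * f' (f t, g t) (0, 1)) * h" for h
    proof -
      have "(a * h, b * h) = (a * h) *\<^sub>R (1, 0) + (b * h) *\<^sub>R (0, 1 :: real)" by simp
      then show ?thesis
        by (simp only: blinfun.add_right blinfun.scaleR_right) (simp add: algebra_simps)
    qed
    ultimately show "((\<lambda>u. vol (f u) (g u)) has_real_derivative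
        a * f' (f t, g t) (1, 0) + b * f' (f t, g t) (0, 1)) (at t)"
      by (simp add: has_field_derivative_def)
  next
    fix F :: real
    assume "F > 0"
    have "continuous_on ({0<..} \<times> {0<..}) f'"
      by (intro continuous_at_imp_continuous_on ballI has_derivative_continuous[OF f''])
    then have "continuous_on {0<..} (\<lambda>K. f' (K, F))"
      by (rule continuous_on_compose2) (use \<open>F > 0\<close> in \<open>auto intro!: continuous_intros\<close>)
    then show "continuous_on {0<..} (\<lambda>K. f' (K, F) (0, 1))"
      by (intro continuous_intros)
  qed
qed

section \<open>The two formulas for the gap\<close>

text \<open>Since \<open>deriv\<close> and the integral are total functions, differentiability of
  the fair variance and integrability of both integrands are asserted as well; this excludes
  equations between default values.\<close>

theorem proposition2p5:
  fixes T F :: real and vol :: "real \<Rightarrow> real \<Rightarrow> real"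
  assumes "T > 0"
    and "implied_vol_smile vol"
    and "variance_swap_assumptions T vol"
    and "F > 0"
  shows "fair_variance T vol field_differentiable at F \<and>
         set_integrable lborel {0<..}
           (\<lambda>K. bs_vega T F K (vol K F) * deriv (\<lambda>G. vol K G) F / K\<^sup>2) \<and>
         bs_variance_delta T vol F - deriv (fair_variance T vol) F =
           - (2 / T) * (LBINT K:{0<..}.
               bs_vega T F K (vol K F) * deriv (\<lambda>G. vol K G) F / K\<^sup>2) \<and>
         integrable lborel (\<lambda>x. std_normal_density (logm_d2 T vol x F) *
           (1 / F * deriv (\<lambda>y. logm_smile vol y F) x - deriv (\<lambda>G. logm_smile vol x G) F)) \<and>
         - (2 / T) * (LBINT K:{0<..}.
             bs_vega T F K (vol K F) * deriv (\<lambda>G. vol K G) F / K\<^sup>2) =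
           2 / sqrt T * (LBINT x. std_normal_density (logm_d2 T vol x F) *
             (1 / F * deriv (\<lambda>y. logm_smile vol y F) x - deriv (\<lambda>G. logm_smile vol x G) F))"
proof -
  note T = \<open>T > 0\<close> and F = \<open>F > 0\<close>
  have vol_pos: "vol K G > 0" if "K > 0" "G > 0" for K G
    using assms(2) that by (simp add: implied_vol_smile_def)
  obtain vK vF where
    chain: "\<And>f g t a b. f t > 0 \<Longrightarrow> g t > 0 \<Longrightarrow> (f has_real_derivative a) (at t) \<Longrightarrow>
      (g has_real_derivative b) (at t) \<Longrightarrow>
      ((\<lambda>u. vol (f u) (g u)) has_real_derivative a * vK (f t) (g t) + b * vF (f t) (g t)) (at t)"
    and cont_vF: "\<And>F. F > 0 \<Longrightarrow> continuous_on {0<..} (\<lambda>K. vF K F)"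
    using C2_on_partials[of vol] assms(2) unfolding implied_vol_smile_def by blast
  have vF: "((\<lambda>G. vol K G) has_real_derivative vF K G) (at G)" if "K > 0" "G > 0" for K G
    using chain[of "\<lambda>_. K" G "\<lambda>u. u" 0 1] that by simp
  then have deriv_vol: "deriv (\<lambda>G. vol K G) G = vF K G" if "K > 0" "G > 0" for K G
    using that by (simp add: DERIV_imp_deriv)
  have cont_vol: "continuous_on {0<..} (\<lambda>K. vol K F)"
    using chain[of "\<lambda>u. u" _ "\<lambda>_. F" 1 0] F
    by (intro continuous_at_imp_continuous_on ballI DERIV_isCont) auto

  \<comment> \<open>Weighted prices and Greeks with their dominating functions\<close>
  define p where "p = (\<lambda>G K. bs_put T G K (vol K G) / K\<^sup>2)"
  define c where "c = (\<lambda>G K. bs_call T G K (vol K G) / K\<^sup>2)"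
  define dp where "dp = (\<lambda>G K. bs_put_delta T G K (vol K G) / K\<^sup>2)"
  define dc where "dc = (\<lambda>G K. bs_call_delta T G K (vol K G) / K\<^sup>2)"
  define ve where "ve = (\<lambda>G K. bs_vega T G K (vol K G) * deriv (\<lambda>G. vol K G) G / K\<^sup>2)"
  have int: "set_integrable lborel {0<..G} (p G)" "set_integrable lborel {G..} (c G)"
      "set_integrable lborel {0<..G} (dp G)" "set_integrable lborel {G..} (dc G)" if "G > 0" for G
    using assms(3) that by (simp_all add: variance_swap_assumptions_def p_def c_def dp_def dc_def)
  obtain wp wc wv where w: "integrable lborel wp" "integrable lborel wc" "integrable lborel wv"
    and ev: "\<forall>\<^sub>F G in nhds F. \<forall>K\<in>{0<..G}. \<bar>dp G K\<bar> \<le> wp K"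
      "\<forall>\<^sub>F G in nhds F. \<forall>K\<in>{G..}. \<bar>dc G K\<bar> \<le> wc K"
      "\<forall>\<^sub>F G in nhds F. \<forall>K\<in>{0<..}. \<bar>ve G K\<bar> \<le> wv K"
    using assms(3) F
    unfolding variance_swap_assumptions_def locally_uniformly_dominated_def
      dp_def[symmetric] dc_def[symmetric] ve_def[symmetric] by meson
  have "\<forall>\<^sub>F G in nhds F. G > 0"
    using eventually_nhds_in_open[of "{0<..}" F] F by simp
  with ev have "\<forall>\<^sub>F G in nhds F. G > 0 \<and> (\<forall>K\<in>{0<..G}. \<bar>dp G K\<bar> \<le> wp K) \<and>
      (\<forall>K\<in>{G..}. \<bar>dc G K\<bar> \<le> wc K) \<and> (\<forall>K\<in>{0<..}. \<bar>ve G K\<bar> \<le> wv K)"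
    by eventually_elim auto
  \<comment> \<open>A closed interval around \<open>F\<close> on which all bounds hold at once: the
    mean value argument needs them at every intermediate forward.\<close>
  then obtain e where e: "e > 0" and "\<And>G. dist G F \<le> e \<Longrightarrow> G > 0 \<and> (\<forall>K\<in>{0<..G}. \<bar>dp G K\<bar> \<le> wp K) \<and>
      (\<forall>K\<in>{G..}. \<bar>dc G K\<bar> \<le> wc K) \<and> (\<forall>K\<in>{0<..}. \<bar>ve G K\<bar> \<le> wv K)"
    unfolding eventually_nhds_metric_le by blast
  then have near: "G > 0" "K > 0 \<Longrightarrow> K \<le> G \<Longrightarrow> \<bar>dp G K\<bar> \<le> wp K"
      "G \<le> K \<Longrightarrow> \<bar>dc G K\<bar> \<le> wc K" "K > 0 \<Longrightarrow> \<bar>ve G K\<bar> \<le> wv K" if "G \<in> {F - e..F + e}" for G K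
    using that by (auto simp: dist_real_def abs_le_iff)

  \<comment> \<open>Integrability of the vega term\<close>
  have ve_cont: "continuous_on {0<..} (\<lambda>K. K * sqrt T * std_normal_density (bs_d2 T F K (vol K F)) * vF K F / K\<^sup>2)"
    unfolding bs_d2_def std_normal_density_def
    using T F vol_pos
    by (intro continuous_intros cont_vol cont_vF) (auto simp: less_imp_neq[symmetric])
  have ve_eq: "ve F K = K * sqrt T * std_normal_density (bs_d2 T F K (vol K F)) * vF K F / K\<^sup>2"
    if "K > 0" for K
    using that T F vol_pos by (simp add: ve_def bs_vega_eq deriv_vol)
  \<comment> \<open>Domination supplies only a bound; measurability comes from the continuity in
    \<open>K\<close> of the closed form of vega.\<close>
  have ve_int: "set_integrable lborel {0<..} (ve F)"
  proof -
    have "continuous_on {0<..} (ve F)"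
      using ve_cont by (rule continuous_on_eq) (simp add: ve_eq)
    then have "(\<lambda>K. indicator {0<..} K *\<^sub>R ve F K) \<in> borel_measurable borel"
      by (intro borel_measurable_continuous_on_indicator) auto
    moreover have "norm (indicator {0<..} K *\<^sub>R ve F K) \<le> norm (wv K)" for K
      using near(4)[of F K] e by (auto simp: indicator_def)
    ultimately show ?thesis
      unfolding set_integrable_def by (intro Bochner_Integration.integrable_bound[OF w(3)]) auto
  qed

  \<comment> \<open>Differentiation of the fair variance\<close>
  have p_der: "((\<lambda>G. p G K) has_real_derivative dp G K + ve G K) (at G)"
    and c_der: "((\<lambda>G. c G K) has_real_derivative dc G K + ve G K) (at G)"
    if "K > 0" "G > 0" for K G
  proof -
    show "((\<lambda>G. p G K) has_real_derivative dp G K + ve G K) (at G)"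
      using DERIV_cdivide[OF bs_put_smile_derivative[of T G K "vol K" "vF K G"], of "K\<^sup>2"] that T vol_pos vF
      by (simp add: p_def dp_def ve_def deriv_vol add_divide_distrib)
    show "((\<lambda>G. c G K) has_real_derivative dc G K + ve G K) (at G)"
      using DERIV_cdivide[OF bs_call_smile_derivative[of T G K "vol K" "vF K G"], of "K\<^sup>2"] that T vol_pos vF
      by (simp add: c_def dc_def ve_def deriv_vol add_divide_distrib)
  qed

  \<comment> \<open>Both integrals are merged into one over the whole line, so that the moving
    limits become a dependence of the integrand on \<open>G\<close>; \<open>d\<close> is the
    candidate for its derivative.\<close>
  define q where "q = (\<lambda>G K. indicator {0<..G} K *\<^sub>R p G K + indicator {G..} K *\<^sub>R c G K)"
  define d where "d = (\<lambda>K. (indicator {0<..F} K *\<^sub>R dp F K + indicator {F..} K *\<^sub>R dc F K)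
      + indicator {0<..} K *\<^sub>R ve F K)"
  \<comment> \<open>Absolute values are taken because \<open>wp\<close>, \<open>wc\<close> and
    \<open>wv\<close> may be negative outside the domains on which they serve as bounds.\<close>
  define w where "w = (\<lambda>K. \<bar>wp K\<bar> + \<bar>wc K\<bar> + \<bar>wv K\<bar>)"
  have q_int: "integrable lborel (q G)" if "G > 0" for G
    using int(1,2)[OF that] unfolding q_def set_integrable_def by (rule Bochner_Integration.integrable_add)
  have fair_eq: "fair_variance T vol G = 2 / T * (\<integral>K. q G K \<partial>lborel)" if "G > 0" for G
  proof -
    have "(\<integral>K. q G K \<partial>lborel) = (LBINT K:{0<..G}. p G K) + (LBINT K:{G..}. c G K)"
      using int(1,2)[OF that] unfolding q_def set_integrable_def set_lebesgue_integral_def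
      by (rule Bochner_Integration.integral_add)
    then show ?thesis
      by (simp add: fair_variance_def p_def c_def algebra_simps)
  qed
  \<comment> \<open>At \<open>K = G\<close> both indicators fire and \<open>q\<close> counts the price twice.\<close>
  have q_eq: "q G K = (if K \<le> 0 then 0 else if K \<le> G then p G K else c G K)"
    if "K \<noteq> G" "G > 0" for G K
    using that by (auto simp: q_def)
  have q_lip: "\<bar>q G K - q F K\<bar> \<le> w K * \<bar>G - F\<bar>"
    if G: "G \<in> {F - e..F + e}" and "K \<noteq> G" "K \<noteq> F" for G K
  proof (cases "K > 0")
    case True
    have "\<bar>(if K \<le> G then p G K else c G K) - (if K \<le> F then p F K else c F K)\<bar> \<le> w K * \<bar>G - F\<bar>"
    \<comment> \<open>The variable is the forward and the kink sits at the strike: calls below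
      \<open>K\<close>, puts above. The branches agree there by parity, as \<open>F - K\<close>
      vanishes.\<close>
    proof (rule kink_lipschitz[where a = "F - e" and b = "F + e"
          and p' = "\<lambda>z. dp z K + ve z K" and c' = "\<lambda>z. dc z K + ve z K"])
      fix z assume z: "z \<in> {F - e..F + e}"
      have ve_le: "\<bar>ve z K\<bar> \<le> \<bar>wv K\<bar>" using near(4)[OF z True] by simp
      show "((\<lambda>G. p G K) has_real_derivative dp z K + ve z K) (at z) \<and> \<bar>dp z K + ve z K\<bar> \<le> w K"
        if "K \<le> z"
        using p_der[OF True near(1)[OF z]] near(2)[OF z True that] ve_le by (auto simp: w_def)
      show "((\<lambda>G. c G K) has_real_derivative dc z K + ve z K) (at z) \<and> \<bar>dc z K + ve z K\<bar> \<le> w K"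
        if "z \<le> K"
        using c_der[OF True near(1)[OF z]] near(3)[OF z that] ve_le by (auto simp: w_def)
    qed (use G e in \<open>auto simp: p_def c_def bs_call_eq\<close>)
    then show ?thesis
      using True that near(1)[OF G] F by (simp add: q_eq)
  next
    case False
    then show ?thesis
      using that near(1)[OF G] F by (simp add: q_eq w_def)
  qed
  \<comment> \<open>Away from \<open>K = F\<close> a single branch of \<open>q\<close> is in force
    for all \<open>G\<close> in an open set around \<open>F\<close>; the three cases name these open
    sets.\<close>
  have q_der: "((\<lambda>G. q G K) has_real_derivative d K) (at F)" if "K \<noteq> F" for K
  proof -
    consider "K \<le> 0" | "0 < K" "K < F" | "F < K" using \<open>K \<noteq> F\<close> by fastforce
    then show ?thesis
    proof cases
      case 1
      have "((\<lambda>G. 0) has_real_derivative 0) (at F)" by simp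
      then have "((\<lambda>G. q G K) has_real_derivative 0) (at F)"
        by (rule has_field_derivative_transform_within_open[where S = "{0<..}"])
           (use F 1 in \<open>auto simp: q_eq\<close>)
      then show ?thesis using 1 F by (simp add: d_def)
    next
      case 2
      have "((\<lambda>G. q G K) has_real_derivative dp F K + ve F K) (at F)"
        using p_der[OF 2(1) F]
        by (rule has_field_derivative_transform_within_open[where S = "{K<..}"])
           (use F 2 in \<open>auto simp: q_eq\<close>)
      then show ?thesis using 2 by (simp add: d_def)
    next
      case 3
      then have "K > 0" using F by simp
      from c_der[OF this F]
      have "((\<lambda>G. q G K) has_real_derivative dc F K + ve F K) (at F)"
        by (rule has_field_derivative_transform_within_open[where S = "{0<..<K}"])
           (use F 3 in \<open>auto simp: q_eq\<close>)
      then show ?thesis using 3 F by (simp add: d_def)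
    qed
  qed
  have d_int: "integrable lborel d"
    using int(3,4)[OF F] ve_int unfolding d_def set_integrable_def
    by (intro Bochner_Integration.integrable_add)
  \<comment> \<open>Both sides count the point \<open>K = F\<close> in the put and in the call
    integral, so linearity alone suffices.\<close>
  have d_eq: "2 / T * (\<integral>K. d K \<partial>lborel) =
      bs_variance_delta T vol F + 2 / T * (LBINT K:{0<..}. ve F K)"
  proof -
    have "(\<integral>K. d K \<partial>lborel) =
        ((LBINT K:{0<..F}. dp F K) + (LBINT K:{F..}. dc F K)) + (LBINT K:{0<..}. ve F K)"
      using int(3,4)[OF F] ve_int unfolding d_def set_integrable_def set_lebesgue_integral_def
      by (simp only: Bochner_Integration.integral_add Bochner_Integration.integrable_add)
    then show ?thesis
      by (simp add: bs_variance_delta_def dp_def dc_def algebra_simps)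
  qed
  have ev_near: "\<forall>\<^sub>F G in nhds F. G \<in> {F - e<..<F + e}"
    using e by (intro eventually_nhds_in_open) auto
  have "((\<lambda>G. \<integral>K. q G K \<partial>lborel) has_real_derivative (\<integral>K. d K \<partial>lborel)) (at F)"
  proof (rule has_real_derivative_integral_dominated[where w = w])
    show "\<forall>\<^sub>F G in nhds F. integrable lborel (q G)"
      using ev_near by eventually_elim (auto intro!: q_int near(1))
    show "integrable lborel w"
      unfolding w_def using w by auto
    show "\<forall>\<^sub>F G in nhds F. AE K in lborel. \<bar>q G K - q F K\<bar> \<le> w K * \<bar>G - F\<bar>"
      using ev_near
    proof eventually_elim
      case (elim G)
      have "G \<in> {F - e..F + e}" using elim by simp
      moreover have "AE K in lborel. K \<noteq> G \<and> K \<noteq> F"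
        using AE_lborel_singleton[of G] AE_lborel_singleton[of F] by (rule eventually_conj)
      ultimately show ?case
        by (elim eventually_mono) (blast intro: q_lip)
    qed
    show "AE K in lborel. ((\<lambda>G. q G K) has_real_derivative d K) (at F)"
      using AE_lborel_singleton[of F] by eventually_elim (rule q_der)
  qed (use d_int in auto)
  from DERIV_cmult[OF this, of "2 / T"]
  \<comment> \<open>The single-integral form of the fair variance is available for positive forwards
    only, which still form an open set around \<open>F\<close>.\<close>
  have fair_der: "(fair_variance T vol has_real_derivative
      bs_variance_delta T vol F + 2 / T * (LBINT K:{0<..}. ve F K)) (at F)"
    unfolding d_eq
    by (rule has_field_derivative_transform_within_open[where S = "{0<..}"])
       (use F fair_eq in auto)

  \<comment> \<open>Passage to log-moneyness\<close>
  have pos: "F * exp x > 0" for x using F by simp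
  \<comment> \<open>With \<open>K = F * exp x\<close>, the factor \<open>K\<close> of vega and the
    Jacobian \<open>K\<close> cancel the weight \<open>K\<^sup>2\<close>; the \<open>sqrt T\<close>
    left over from vega explains the constant \<open>1 / sqrt T\<close>.\<close>
  have integrand: "std_normal_density (logm_d2 T vol x F) *
        (1 / F * deriv (\<lambda>y. logm_smile vol y F) x - deriv (\<lambda>G. logm_smile vol x G) F) =
      - (1 / sqrt T) * (F * exp x * ve F (F * exp x))" for x
  proof -
    have "((\<lambda>y. logm_smile vol y F) has_real_derivative F * exp x * vK (F * exp x) F) (at x)"
      unfolding logm_smile_def
      using chain[of "\<lambda>y. F * exp y" x "\<lambda>_. F" "F * exp x" 0] F DERIV_cmult[OF DERIV_exp, of F x]
      by simp
    moreover have "((\<lambda>G. logm_smile vol x G) has_real_derivative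
        exp x * vK (F * exp x) F + vF (F * exp x) F) (at F)"
      unfolding logm_smile_def
      using chain[of "\<lambda>G. G * exp x" F "\<lambda>G. G" "exp x" 1] F
        DERIV_cmult_right[OF DERIV_ident, where c = "exp x" and x = F and s = UNIV]
      by simp
    \<comment> \<open>At fixed \<open>x\<close> the strike moves with the forward, which adds
      \<open>exp x\<close> times the strike slope \<open>vK\<close>. The term \<open>1 / F\<close>
      times the slope in \<open>x\<close> removes exactly this contribution and leaves the
      fixed-strike slope with a minus sign.\<close>
    ultimately have "1 / F * deriv (\<lambda>y. logm_smile vol y F) x - deriv (\<lambda>G. logm_smile vol x G) F
        = - vF (F * exp x) F"
      using F by (simp add: DERIV_imp_deriv)
    moreover have "bs_d2 T F (F * exp x) (vol (F * exp x) F) = logm_d2 T vol x F"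
      using F by (simp add: bs_d2_def logm_d2_def logm_smile_def ln_div ln_mult)
    ultimately show ?thesis
      using F T pos[of x] by (simp add: ve_eq power2_eq_square)
  qed
  note subst = lborel_substitution_exp[OF ve_int F]
  have "integrable lborel (\<lambda>x. - (1 / sqrt T) * (F * exp x * ve F (F * exp x)))"
    by (intro Bochner_Integration.integrable_mult_right subst(1))
  moreover have "2 / sqrt T * (LBINT x. - (1 / sqrt T) * (F * exp x * ve F (F * exp x))) =
      - (2 / T) * (LBINT K:{0<..}. ve F K)"
    using T by (simp only: Bochner_Integration.integral_mult_right_zero subst(2)) simp
  moreover have "(\<lambda>K. bs_vega T F K (vol K F) * deriv (\<lambda>G. vol K G) F / K\<^sup>2) = ve F"
    by (simp add: ve_def)
  ultimately show ?thesis
    using fair_der ve_int DERIV_imp_deriv[OF fair_der]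
    unfolding integrand by (auto simp only: field_differentiable_def)
qed

end
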